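(* Let $f:\mathbb{R}^m\to\overline{\mathbb{R}}$, $f(x)=p(x)+q(x)$, where $q\in\mathcal{C}^2$ and $p$ is a (nonsmooth) PDG function having a fast track at the given point $\bar{x}\in\operatorname{dom}f$. Let $\overline{U}$ be a $\mathcal{U}$-basis matrix for $p$ at $\bar{x}$. Then $$\nabla_{\mathcal{U}}f(\bar{x})=\nabla_{\mathcal{U}}p(\bar{x})+\overline{U}\,\overline{U}^\top\nabla q(\bar{x})=\nabla_{\mathcal{U}}p(\bar{x})+\overline{U}(\nabla q(\bar{x}))_{\mathcal{U}},$$ and the $\mathcal{U}$-space of $f$ at $\bar{x}$ is the $\mathcal{U}$-space of $p$ at $\bar{x}$.
   Context: $\overline{\mathbb{R}}=\mathbb{R}\cup\{+\infty\}$; lsc means lower semicontinuous; $\partial f$ is the limiting (Mordukhovich) subdifferential; $\operatorname{ri}$ is relative interior; $N_S$ is the limiting normal cone. A set $\mathcal{M}\subseteq\mathbb{R}^n$ is a $d$-dimensional ($\mathcal{C}^2$) manifold about $\bar{x}\in\mathcal{M}$ if near $\bar{x}$ it is the solution set of $F(x)=0$ for a $\mathcal{C}^2$ map $F$ into $\mathbb{R}^{n-d}$ with surjective Jacobian at $\bar x$. PDG structure: an lsc $f:\mathbb{R}^n\to\overline{\mathbb{R}}$ has primal-dual gradient (PDG) structure at $\bar{x}$ relative to a manifold $\mathcal{M}\subseteq\mathbb{R}^n$ if there are functions $f_0,\dots,f_{m_1},\varphi_1,\dots,\varphi_{m_2}$ that are $\mathcal{C}^2$ on a ball $B_\delta(\bar{x})$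 and a closed convex set $\Delta\subseteq\mathbb{R}^{m_1+1+m_2}$ such that: (i) $\bar{x}\in\{x\in B_\delta(\bar{x}):f_i(x)=f(x)\ \forall i,\ \varphi_j(x)=0\ \forall j\}\subseteq\mathcal{M}\cap B_\delta(\bar{x})$; (ii) $(\alpha,\beta)\in\Delta$ implies $\alpha_i\ge 0$ and $\sum_{i=0}^{m_1}\alpha_i=1$; (iii) for $i=0,\dots,m_1$ the canonical vector with $\alpha_i=1$ and all other entries zero is in $\Delta$; (iv) for each $\bar{j}$ there is $(\alpha,\beta)\in\Delta$ with $\beta_{\bar{j}}\ne0$ and $\beta_j=0$ for $j\neq\bar{j}$; (v) for each $x\in\mathcal{M}\cap B_\delta(\bar{x})$: $f(x)=f_i(x)$ for some $i$, and $g\in\partial f(x)$ iff $g=\sum_i\alpha_i\nabla f_i(x)+\sum_j\beta_j\nabla\varphi_j(x)$ for some $(\alpha,\beta)\in\Delta$ with $\alpha_i=0$ whenever $f_i(x)\ne f(x)$ and $\beta_j=0$ whenever $\varphi_j(x)\neq0$. $\mathcal{VU}$-decomposition: for $f$ lsc with $\partial f(\bar{x})\ne\emptyset$ and any $\bar{g}\in\operatorname{ri}\partial f(\bar{x})$, $\mathcal{V}=\operatorname{span}(\partial f(\bar{x})-\bar{g})$ and $\mathcal{U}=N_{\partial f(\bar{x})}(\bar{g})$ (orthogonally complementary subspaces, independent of $\bar{g}$). $\overline{V}$ denotes a matrix whose columns form a basis of $\mathcal{V}$; a $\mathcal{U}$-basis matrix $\overline{U}$ is a matrix whose columns form an orthonormal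 basis of $\mathcal{U}$; the restriction of a vector $x$ to the $\mathcal{U}$-space is $x_{\mathcal{U}}=\overline{U}^\top x$. Vectors of $\mathcal{U},\mathcal{V}$ are identified with their coordinates with respect to $\overline{U},\overline{V}$. $\mathcal{U}$-Lagrangian (for $f$ PDG at $\bar x$): $L_{\mathcal{U}}f(u;\bar{g})=\min_{v\in\mathcal{V}}\{f(\bar{x}+\overline{U}u+\overline{V}v)-\bar{g}^\top\overline{V}v\}$, and $W_{\mathcal{U}}f(u;\bar{g})$ is the corresponding set of minimizers $v$. Fast track: let $f$ be PDG at $\bar{x}$ relative to a $d$-dimensional manifold, with $\dim\mathcal{V}=n-d$. The function $\chi(u)=\bar{x}+\overline{U}u+\overline{V}v(u)$, $v:\mathcal{U}\to\mathcal{V}$, is a fast track of $f$ at $\bar{x}$ if for every $\bar{g}\in\operatorname{ri}\partial f(\bar{x})$ and for $u$ near $0$: (i) $v$ is $\mathcal{C}^2$ with $v(u)\in W_{\mathcal{U}}f(u;\bar{g})$; (ii) $L_{\mathcal{U}}f(u;\bar{g})$ is $\mathcal{C}^2$ in $u$. $\mathcal{U}$-gradient: $\nabla_{\mathcal{U}}f(\bar{x})=\overline{U}\,\nabla L_{\mathcal{U}}f(\bar{x})\in\mathbb{R}^n$, where $\nabla L_{\mathcal{U}}f(\bar{x})$ is the gradient of $u\mapsto L_{\mathcal{U}}f(u;\bar{g})$ at $u=0$.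
   Formalization: The minimum over all v in V in the U-Lagrangian, its minimizer set, the fast track and the U-gradient is taken locally, over small balls about v=0; with the global minimum the U-gradient of f need not exist (p=|x|+y^2, q=-x^4). *)

theory Defs
  imports "HOL-Analysis.Analysis"
begin

section \<open>Smoothness\<close>

definition C2_on :: "'a::euclidean_space set \<Rightarrow> ('a \<Rightarrow> 'b::euclidean_space) \<Rightarrow> bool" where
  "C2_on S f \<longleftrightarrow> open S \<and>
    (\<exists>(f' :: 'a \<Rightarrow> 'a \<Rightarrow>\<^sub>L 'b) (f'' :: 'a \<Rightarrow> 'a \<Rightarrow>\<^sub>L ('a \<Rightarrow>\<^sub>L 'b)).
      (\<forall>x\<in>S. (f has_derivative blinfun_apply (f' x)) (at x)) \<and>
      (\<forall>x\<in>S. (f' has_derivative blinfun_apply (f'' x)) (at x)) \<and>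
      continuous_on S f'')"

definition grad :: "('a::euclidean_space \<Rightarrow> real) \<Rightarrow> 'a \<Rightarrow> 'a" where
  "grad f x = (THE D. GDERIV f x :> D)"

text \<open>The Jacobian of \<open>F = (F 0, \<dots>, F (n - d - 1))\<close> at \<open>xb\<close> is the map sending \<open>h\<close> to
  \<open>(grad (F i) xb \<bullet> h)\<close>, \<open>i < n - d\<close>.  The components are indexed by numbers rather than by a
  type so that \<open>d = n\<close> is possible.\<close>

definition C2_manifold :: "nat \<Rightarrow> (real^'n) set \<Rightarrow> real^'n \<Rightarrow> bool" where
  "C2_manifold d M xb \<longleftrightarrow> d \<le> CARD('n) \<and> xb \<in> M \<and>
    (\<exists>\<delta>>0. \<exists>F :: nat \<Rightarrow> real^'n \<Rightarrow> real.
      (\<forall>i < CARD('n) - d. C2_on (ball xb \<delta>) (F i)) \<and>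
      M \<inter> ball xb \<delta> = {x \<in> ball xb \<delta>. \<forall>i < CARD('n) - d. F i x = 0} \<and>
      (\<forall>y :: nat \<Rightarrow> real. \<exists>h. \<forall>i < CARD('n) - d. grad (F i) xb \<bullet> h = y i))"


section \<open>Variational analysis\<close>

text \<open>Functions into \<open>\<real> \<union> {+\<infinity>}\<close> are functions into \<^typ>\<open>ereal\<close> that avoid \<open>-\<infinity>\<close>.\<close>

definition lsc :: "(real^'n \<Rightarrow> ereal) \<Rightarrow> bool" where
  "lsc f \<longleftrightarrow> (\<forall>x. f x \<le> Liminf (at x) f)"

definition regular_subdiff :: "(real^'n \<Rightarrow> ereal) \<Rightarrow> real^'n \<Rightarrow> (real^'n) set" where
  "regular_subdiff f x = {g. \<bar>f x\<bar> \<noteq> \<infinity> \<and>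
     (\<forall>e>0. \<forall>\<^sub>F y in at x. f x + ereal (g \<bullet> (y - x) - e * norm (y - x)) \<le> f y)}"

definition limiting_subdiff :: "(real^'n \<Rightarrow> ereal) \<Rightarrow> real^'n \<Rightarrow> (real^'n) set" where
  "limiting_subdiff f x = {g. \<bar>f x\<bar> \<noteq> \<infinity> \<and>
     (\<exists>X G. X \<longlonglongrightarrow> x \<and> (\<lambda>k. f (X k)) \<longlonglongrightarrow> f x \<and>
            (\<forall>k. G k \<in> regular_subdiff f (X k)) \<and> G \<longlonglongrightarrow> g)}"

definition regular_normal_cone :: "(real^'n) set \<Rightarrow> real^'n \<Rightarrow> (real^'n) set" where
  "regular_normal_cone S x = {w. x \<in> S \<and>
     (\<forall>e>0. \<forall>\<^sub>F y in at x within S. w \<bullet> (y - x) \<le> e * norm (y - x))}"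

definition limiting_normal_cone :: "(real^'n) set \<Rightarrow> real^'n \<Rightarrow> (real^'n) set" where
  "limiting_normal_cone S x = {w. x \<in> S \<and>
     (\<exists>X G. X \<longlonglongrightarrow> x \<and> (\<forall>k. X k \<in> S \<and> G k \<in> regular_normal_cone S (X k)) \<and> G \<longlonglongrightarrow> w)}"


section \<open>Primal-dual gradient structure\<close>

text \<open>A vector \<open>(\<alpha>, \<beta>)\<close> of length \<open>m1 + 1 + m2\<close> is a pair of sequences with \<open>\<alpha>\<close> supported on
  \<open>{0..m1}\<close> and \<open>\<beta>\<close> on \<open>{1..m2}\<close>; on such pairs the product topology in which \<open>closed \<Delta>\<close> is read
  is the Euclidean one.  Convexity is written out since sequences are not an instance of
  \<^class>\<open>real_vector\<close>.\<close>

definition PDG_structure :: "(real^'n \<Rightarrow> ereal) \<Rightarrow> real^'n \<Rightarrow> (real^'n) set \<Rightarrow> bool" where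
  "PDG_structure f xb M \<longleftrightarrow>
    lsc f \<and> (\<forall>x. f x \<noteq> -\<infinity>) \<and> (\<exists>d. C2_manifold d M xb) \<and>
    (\<exists>(\<delta>::real) (m1::nat) (m2::nat) (F :: nat \<Rightarrow> real^'n \<Rightarrow> real) (\<phi> :: nat \<Rightarrow> real^'n \<Rightarrow> real)
       (\<Delta> :: ((nat \<Rightarrow> real) \<times> (nat \<Rightarrow> real)) set).
      \<delta> > 0 \<and>
      (\<forall>i\<le>m1. C2_on (ball xb \<delta>) (F i)) \<and>
      (\<forall>j\<in>{1..m2}. C2_on (ball xb \<delta>) (\<phi> j)) \<and>
      (\<forall>(\<alpha>, \<beta>)\<in>\<Delta>. (\<forall>i. i \<notin> {0..m1} \<longrightarrow> \<alpha> i = 0) \<and> (\<forall>j. j \<notin> {1..m2} \<longrightarrow> \<beta> j = 0)) \<and>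
      closed \<Delta> \<and>
      (\<forall>(\<alpha>, \<beta>)\<in>\<Delta>. \<forall>(\<alpha>', \<beta>')\<in>\<Delta>. \<forall>t\<in>{0..1}.
         (\<lambda>i. (1 - t) * \<alpha> i + t * \<alpha>' i, \<lambda>j. (1 - t) * \<beta> j + t * \<beta>' j) \<in> \<Delta>) \<and>
      xb \<in> {x \<in> ball xb \<delta>. (\<forall>i\<le>m1. ereal (F i x) = f x) \<and> (\<forall>j\<in>{1..m2}. \<phi> j x = 0)} \<and>
      {x \<in> ball xb \<delta>. (\<forall>i\<le>m1. ereal (F i x) = f x) \<and> (\<forall>j\<in>{1..m2}. \<phi> j x = 0)}
        \<subseteq> M \<inter> ball xb \<delta> \<and>
      (\<forall>(\<alpha>, \<beta>)\<in>\<Delta>. (\<forall>i\<le>m1. \<alpha> i \<ge> 0) \<and> (\<Sum>i\<le>m1. \<alpha> i) = 1) \<and>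
      (\<forall>i\<le>m1. (\<lambda>k. if k = i then 1 else 0, \<lambda>j. 0) \<in> \<Delta>) \<and>
      (\<forall>jb\<in>{1..m2}. \<exists>(\<alpha>, \<beta>)\<in>\<Delta>. \<beta> jb \<noteq> 0 \<and> (\<forall>j\<in>{1..m2}. j \<noteq> jb \<longrightarrow> \<beta> j = 0)) \<and>
      (\<forall>x \<in> M \<inter> ball xb \<delta>.
         (\<exists>i\<le>m1. f x = ereal (F i x)) \<and>
         (\<forall>g. g \<in> limiting_subdiff f x \<longleftrightarrow>
            (\<exists>(\<alpha>, \<beta>)\<in>\<Delta>.
               g = (\<Sum>i\<le>m1. \<alpha> i *\<^sub>R grad (F i) x) + (\<Sum>j\<in>{1..m2}. \<beta> j *\<^sub>R grad (\<phi> j) x) \<and>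
               (\<forall>i\<le>m1. ereal (F i x) \<noteq> f x \<longrightarrow> \<alpha> i = 0) \<and>
               (\<forall>j\<in>{1..m2}. \<phi> j x \<noteq> 0 \<longrightarrow> \<beta> j = 0)))))"


section \<open>VU-decomposition\<close>

text \<open>In both definitions \<open>g\<close> is meant to lie in the relative interior of the subdifferential.\<close>

definition V_space :: "(real^'n \<Rightarrow> ereal) \<Rightarrow> real^'n \<Rightarrow> real^'n \<Rightarrow> (real^'n) set" where
  "V_space f x g = span ((\<lambda>s. s - g) ` limiting_subdiff f x)"

definition U_space :: "(real^'n \<Rightarrow> ereal) \<Rightarrow> real^'n \<Rightarrow> real^'n \<Rightarrow> (real^'n) set" where
  "U_space f x g = limiting_normal_cone (limiting_subdiff f x) g"

text \<open>Index types are nonempty, so the matrix without columns, which is the basis matrix of the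
  zero subspace, is represented by the zero matrix.\<close>

definition basis_matrix :: "real^'k^'n \<Rightarrow> (real^'n) set \<Rightarrow> bool" where
  "basis_matrix A S \<longleftrightarrow>
    (if S = {0} then A = 0
     else inj (\<lambda>i. column i A) \<and> independent (columns A) \<and> span (columns A) = S)"

definition orthonormal_basis_matrix :: "real^'k^'n \<Rightarrow> (real^'n) set \<Rightarrow> bool" where
  "orthonormal_basis_matrix A S \<longleftrightarrow>
    (if S = {0} then A = 0
     else (\<forall>i j. column i A \<bullet> column j A = (if i = j then 1 else 0)) \<and> span (columns A) = S)"

definition restrict_U :: "real^'u^'n \<Rightarrow> real^'n \<Rightarrow> real^'u" where
  "restrict_U U x = transpose U *v x"


section \<open>U-Lagrangian, fast tracks and U-gradient\<close>

text \<open>The theory is local, and the minimum defining the U-Lagrangian is the local one near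
  \<open>v = 0\<close>: \<open>v\<close> ranges over \<open>cball 0 \<epsilon>\<close>, and everything built on it is required for all
  sufficiently small \<open>\<epsilon> > 0\<close>.  Minimising over the whole V-space would make \<open>p + q\<close>
  depend on the values of \<open>q\<close> far from \<open>xb\<close>: for \<open>p (x, y) = \<bar>x\<bar> + y\<^sup>2\<close>, \<open>q (x, y) = - x^4\<close> and
  \<open>xb = 0\<close> that minimum does not exist.  Wherever the global minimisers tend to \<open>0\<close> with \<open>u\<close>,
  as for a fast track through \<open>xb\<close>, both minima agree for \<open>u\<close> near \<open>0\<close>.
  For a lower semicontinuous \<open>f\<close> avoiding \<open>-\<infinity>\<close> the infimum is attained, the ball being compact.\<close>

definition U_objective ::
  "(real^'n \<Rightarrow> ereal) \<Rightarrow> real^'n \<Rightarrow> real^'u^'n \<Rightarrow> real^'v^'n \<Rightarrow> real^'n \<Rightarrow> real^'u \<Rightarrow> real^'v \<Rightarrow> ereal"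
  where "U_objective f xb U V g u v = f (xb + U *v u + V *v v) - ereal (g \<bullet> (V *v v))"

definition U_Lagrangian ::
  "real \<Rightarrow> (real^'n \<Rightarrow> ereal) \<Rightarrow> real^'n \<Rightarrow> real^'u^'n \<Rightarrow> real^'v^'n \<Rightarrow> real^'n \<Rightarrow> real^'u \<Rightarrow> ereal"
  where "U_Lagrangian \<epsilon> f xb U V g u = (INF v \<in> cball 0 \<epsilon>. U_objective f xb U V g u v)"

definition U_minimizers ::
  "real \<Rightarrow> (real^'n \<Rightarrow> ereal) \<Rightarrow> real^'n \<Rightarrow> real^'u^'n \<Rightarrow> real^'v^'n \<Rightarrow> real^'n \<Rightarrow> real^'u \<Rightarrow> (real^'v) set"
  where "U_minimizers \<epsilon> f xb U V g u =
    {v \<in> cball 0 \<epsilon>. \<forall>w \<in> cball 0 \<epsilon>. U_objective f xb U V g u v \<le> U_objective f xb U V g u w}"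

definition fast_track ::
  "(real^'n \<Rightarrow> ereal) \<Rightarrow> real^'n \<Rightarrow> (real^'n) set \<Rightarrow> nat \<Rightarrow> real^'u^'n \<Rightarrow> real^'v^'n
     \<Rightarrow> (real^'u \<Rightarrow> real^'n) \<Rightarrow> bool"
  where "fast_track f xb M d U V track \<longleftrightarrow>
    PDG_structure f xb M \<and> C2_manifold d M xb \<and>
    (\<forall>g \<in> rel_interior (limiting_subdiff f xb). dim (V_space f xb g) = CARD('n) - d) \<and>
    (\<exists>v :: real^'u \<Rightarrow> real^'v. (\<forall>u. track u = xb + U *v u + V *v (v u)) \<and>
      (\<forall>g \<in> rel_interior (limiting_subdiff f xb). \<forall>\<^sub>F \<epsilon> in at_right 0. \<exists>r>0.
         C2_on (ball 0 r) v \<and>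
         (\<forall>u \<in> ball 0 r. v u \<in> U_minimizers \<epsilon> f xb U V g u) \<and>
         (\<exists>l :: real^'u \<Rightarrow> real. C2_on (ball 0 r) l \<and>
            (\<forall>u \<in> ball 0 r. U_Lagrangian \<epsilon> f xb U V g u = ereal (l u)))))"

definition Lagrangian_gradient ::
  "(real^'n \<Rightarrow> ereal) \<Rightarrow> real^'n \<Rightarrow> real^'u^'n \<Rightarrow> real^'v^'n \<Rightarrow> real^'n \<Rightarrow> real^'u \<Rightarrow> bool"
  where "Lagrangian_gradient f xb U V g D \<longleftrightarrow>
    (\<forall>\<^sub>F \<epsilon> in at_right 0. \<exists>l :: real^'u \<Rightarrow> real.
       (\<forall>\<^sub>F u in nhds 0. U_Lagrangian \<epsilon> f xb U V g u = ereal (l u)) \<and> (GDERIV l 0 :> D))"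

definition U_differentiable ::
  "(real^'n \<Rightarrow> ereal) \<Rightarrow> real^'n \<Rightarrow> real^'u^'n \<Rightarrow> real^'v^'n \<Rightarrow> real^'n \<Rightarrow> bool"
  where "U_differentiable f xb U V g \<longleftrightarrow> (\<exists>D. Lagrangian_gradient f xb U V g D)"

definition U_gradient ::
  "(real^'n \<Rightarrow> ereal) \<Rightarrow> real^'n \<Rightarrow> real^'u^'n \<Rightarrow> real^'v^'n \<Rightarrow> real^'n \<Rightarrow> real^'n"
  where "U_gradient f xb U V g = U *v (THE D. Lagrangian_gradient f xb U V g D)"

end

theory Submission
  imports Defs
begin

text \<open>If \<open>v\<close> is the V-part of the fast track of \<open>p\<close>, the minimality of \<open>v u\<close> for all dual
  parameters in a relative neighbourhood of \<open>g\<close> gives, with \<open>\<chi> u = xb + U u + V (v u)\<close>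
  and some \<open>c > 0\<close>, for \<open>u\<close> and \<open>w\<close> near \<open>0\<close>: \<open>p (xb + U u + V w) - g \<bullet> V w\<close> is at least
  \<open>p (\<chi> u) - g \<bullet> V (v u) + c * norm (V w - V (v u))\<close>.
  Near \<open>xb\<close> the function \<open>q\<close> minus its linearisation is Lipschitz with constant \<open>c\<close>, so adding
  \<open>q\<close> to \<open>p\<close> and its gradient to \<open>g\<close> keeps \<open>v u\<close> a minimiser.  Hence the U-Lagrangian of
  \<open>f\<close> is that of \<open>p\<close> plus \<open>q (\<chi> u) - grad q xb \<bullet> V (v u)\<close>, whose gradient at \<open>0\<close> is the
  U-part of \<open>grad q xb\<close>.  The parameters \<open>gp\<close> and \<open>gf - grad q xb\<close> may differ, which
  does not matter because the U-gradient of \<open>p\<close> is the projection of any subgradient to the U-space.\<close>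

section \<open>Gradients of C2 functions\<close>

lemma differentiable_imp_GDERIV:
  fixes f :: "'a::euclidean_space \<Rightarrow> real"
  assumes "f differentiable (at x)"
  obtains D where "GDERIV f x :> D"
proof -
  obtain f' where f': "(f has_derivative f') (at x)"
    using assms unfolding differentiable_def by blast
  then have "linear f'" by (rule has_derivative_linear)
  then have "f' = (\<lambda>h. h \<bullet> adjoint f' 1)"
    by (simp add: fun_eq_iff adjoint_works)
  with f' have "GDERIV f x :> adjoint f' 1" by (metis gderiv_def)
  then show ?thesis by (rule that)
qed

lemma GDERIV_unique:
  assumes "GDERIV f x :> D" "GDERIV f x :> E"
  shows "D = E"
  using has_derivative_unique[OF assms[unfolded gderiv_def]]
  by (metis inner_commute vector_eq_ldot)

lemma C2_on_imp_differentiable: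
  assumes "C2_on S f" "x \<in> S"
  shows "f differentiable (at x)"
  using assms unfolding C2_on_def differentiable_def by blast

lemma C2_on_GDERIV:
  fixes f :: "'a::euclidean_space \<Rightarrow> real"
  assumes "C2_on S f" "x \<in> S"
  shows "GDERIV f x :> grad f x"
  unfolding grad_def
  by (metis theI GDERIV_unique differentiable_imp_GDERIV C2_on_imp_differentiable[OF assms])

lemma continuous_on_grad:
  fixes f :: "'a::euclidean_space \<Rightarrow> real"
  assumes "C2_on S f"
  shows "continuous_on S (grad f)"
proof -
  obtain f' :: "'a \<Rightarrow> 'a \<Rightarrow>\<^sub>L real" and f''
    where f': "\<And>x. x \<in> S \<Longrightarrow> (f has_derivative blinfun_apply (f' x)) (at x)"
      and f'': "\<And>x. x \<in> S \<Longrightarrow> (f' has_derivative blinfun_apply (f'' x)) (at x)"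
    using assms unfolding C2_on_def by blast
  have "f' x h = h \<bullet> grad f x" if "x \<in> S" for x h
    using has_derivative_unique[OF f'[OF that]
        C2_on_GDERIV[OF assms that, unfolded gderiv_def]] by metis
  \<comment> \<open>Coordinates turn continuity of the operator-valued derivative \<open>f'\<close>
    into continuity of \<open>grad f\<close>.\<close>
  then have "grad f x = (\<Sum>b\<in>Basis. f' x b *\<^sub>R b)" if "x \<in> S" for x
    using that euclidean_representation[of "grad f x"] by (simp add: inner_commute[of _ "grad f x"])
  moreover have "continuous_on S f'"
    using f'' by (meson continuous_at_imp_continuous_on has_derivative_continuous)
  then have "continuous_on S (\<lambda>x. \<Sum>b\<in>Basis. f' x b *\<^sub>R b)"
    by (intro continuous_intros)
  ultimately show ?thesis
    by (metis (no_types, lifting) continuous_on_cong)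
qed

section \<open>Subdifferentials of a sum with a smooth function\<close>

lemma regular_subdiff_add_smooth:
  assumes f: "\<And>x. f x = p x + ereal (q x)"
    and q: "GDERIV q x :> D"
    and g: "g \<in> regular_subdiff p x"
  shows "g + D \<in> regular_subdiff f x"
proof -
  have fin: "\<bar>p x\<bar> \<noteq> \<infinity>" using g by (simp add: regular_subdiff_def)
  have "\<forall>\<^sub>F y in at x. f x + ereal ((g + D) \<bullet> (y - x) - e * norm (y - x)) \<le> f y"
    if e: "e > 0" for e
  proof -
    \<comment> \<open>The tolerance \<open>e\<close> is shared equally between the subgradient
      inequality of \<open>p\<close> and the first-order remainder of \<open>q\<close>.\<close>
    have "\<forall>\<^sub>F y in at x. p x + ereal (g \<bullet> (y - x) - e/2 * norm (y - x)) \<le> p y"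
      using g half_gt_zero[OF e] unfolding regular_subdiff_def by blast
    moreover have "\<forall>\<^sub>F y in at x. \<bar>q y - q x - (y - x) \<bullet> D\<bar> \<le> e/2 * norm (y - x)"
    proof -
      obtain d where "d > 0"
        "\<And>y. norm (y - x) < d \<Longrightarrow> norm (q y - q x - (y - x) \<bullet> D) \<le> e/2 * norm (y - x)"
        using q half_gt_zero[OF e] unfolding gderiv_def has_derivative_at_alt by blast
      then show ?thesis
        unfolding eventually_at by (auto simp: dist_norm)
    qed
    ultimately show ?thesis
    proof eventually_elim
      case (elim y)
      have "q x + D \<bullet> (y - x) - e / 2 * norm (y - x) \<le> q y"
        using elim(2) by (simp only: inner_commute[of D] abs_le_iff) linarith
      with elim(1) show ?case
        using fin unfolding f
        by (cases "p x"; cases "p y") (auto simp: inner_add_left)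
    qed
  qed
  then show ?thesis
    using fin by (auto simp: regular_subdiff_def f)
qed

text \<open>Regular subgradients shift by the gradient of \<open>q\<close> at the approximating
  points themselves; continuity of \<open>q\<close> and \<open>grad q\<close> then carries both the
  function values and the shifted subgradients to the limit.\<close>

lemma limiting_subdiff_add_smooth_subset:
  assumes f: "\<And>x. f x = p x + ereal (q x)"
    and q: "C2_on UNIV q"
    and g: "g \<in> limiting_subdiff p x"
  shows "g + grad q x \<in> limiting_subdiff f x"
proof -
  obtain X G where X: "X \<longlonglongrightarrow> x" "(\<lambda>k. p (X k)) \<longlonglongrightarrow> p x"
      and G: "\<And>k. G k \<in> regular_subdiff p (X k)" "G \<longlonglongrightarrow> g" and fin: "\<bar>p x\<bar> \<noteq> \<infinity>"
    using g unfolding limiting_subdiff_def by auto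
  have cont: "isCont (grad q) x" "isCont q x"
    using continuous_on_grad[OF q] C2_on_imp_differentiable[OF q]
    by (auto simp: continuous_on_eq_continuous_at differentiable_imp_continuous_within)
  have "(\<lambda>k. f (X k)) \<longlonglongrightarrow> f x"
    unfolding f using X(2) fin isCont_tendsto_compose[OF cont(2) X(1)]
    by (intro tendsto_add_ereal) auto
  moreover have "(\<lambda>k. G k + grad q (X k)) \<longlonglongrightarrow> g + grad q x"
    by (intro tendsto_add G isCont_tendsto_compose[OF cont(1) X(1)])
  moreover have "G k + grad q (X k) \<in> regular_subdiff f (X k)" for k
    using regular_subdiff_add_smooth[OF f C2_on_GDERIV[OF q] G(1)] by simp
  ultimately show ?thesis
    using X(1) fin unfolding limiting_subdiff_def mem_Collect_eq
    by (intro conjI exI[of _ X] exI[of _ "\<lambda>k. G k + grad q (X k)"]) (auto simp: f)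
qed

lemma C2_on_uminus:
  assumes "C2_on S q"
  shows "C2_on S (\<lambda>x. - q x)"
proof -
  obtain f' f'' where "open S" "\<forall>x\<in>S. (q has_derivative blinfun_apply (f' x)) (at x)"
     "\<forall>x\<in>S. (f' has_derivative blinfun_apply (f'' x)) (at x)" "continuous_on S f''"
    using assms unfolding C2_on_def by blast
  then have "\<forall>x\<in>S. ((\<lambda>x. - q x) has_derivative blinfun_apply (- f' x)) (at x)"
     "\<forall>x\<in>S. ((\<lambda>x. - f' x) has_derivative blinfun_apply (- f'' x)) (at x)"
     "continuous_on S (\<lambda>x. - f'' x)"
    by (auto simp: uminus_blinfun.rep_eq intro: has_derivative_minus continuous_on_minus)
  with \<open>open S\<close> show ?thesis
    unfolding C2_on_def
    by (intro conjI exI[of _ "\<lambda>x. - f' x"] exI[of _ "\<lambda>x. - f'' x"])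
qed

lemma limiting_subdiff_add_smooth:
  assumes f: "\<And>x. f x = p x + ereal (q x)"
    and q: "C2_on UNIV q"
  shows "limiting_subdiff f x = (\<lambda>g. grad q x + g) ` limiting_subdiff p x"
proof (intro equalityI subsetI)
  fix g assume "g \<in> (\<lambda>g. grad q x + g) ` limiting_subdiff p x"
  then show "g \<in> limiting_subdiff f x"
    using limiting_subdiff_add_smooth_subset[OF f q] by (auto simp: add.commute)
next
  fix g assume g: "g \<in> limiting_subdiff f x"
  \<comment> \<open>The identity also holds where \<open>p\<close> is infinite, so the inclusion
    above applies to \<open>f\<close> and the smooth function \<open>- q\<close>.\<close>
  have p: "p y = f y + ereal (- q y)" for y
    unfolding f by (cases "p y") auto
  have "grad (\<lambda>y. - q y) x = - grad q x"
    using GDERIV_unique[OF C2_on_GDERIV[OF C2_on_uminus[OF q]]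
        GDERIV_minus[OF C2_on_GDERIV[OF q]]] by simp
  then have "g - grad q x \<in> limiting_subdiff p x"
    using limiting_subdiff_add_smooth_subset[OF p C2_on_uminus[OF q] g] by simp
  then show "g \<in> (\<lambda>g. grad q x + g) ` limiting_subdiff p x"
    by (force simp: image_iff)
qed

section \<open>Relative interior and the VU-decomposition\<close>

lemma span_diff_base_eq:
  fixes S :: "'a::real_vector set"
  assumes "a \<in> S" "b \<in> S"
  shows "span ((\<lambda>s. s - a) ` S) = span ((\<lambda>s. s - b) ` S)"
proof -
  have "span ((\<lambda>s. s - a) ` S) \<subseteq> span ((\<lambda>s. s - b) ` S)" if "a \<in> S" "b \<in> S" for a b
  proof (rule span_minimal[OF _ subspace_span], safe)
    fix s assume "s \<in> S"
    then have "(s - b) - (a - b) \<in> span ((\<lambda>s. s - b) ` S)"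
      using that by (intro span_diff span_base) auto
    then show "s - a \<in> span ((\<lambda>s. s - b) ` S)" by simp
  qed
  then show ?thesis using assms by blast
qed

text \<open>The affine hull of \<open>S\<close> is the translate of this span by \<open>a\<close>,
  so a relative neighbourhood of \<open>a\<close> contains a full ball of the translated span. For a
  subdifferential this supplies all dual parameters \<open>g + z\<close> with \<open>z\<close> small
  in the V-space.\<close>

lemma rel_interior_add_span:
  assumes "a \<in> rel_interior S"
  obtains e where "e > 0"
    "\<And>z. z \<in> span ((\<lambda>s. s - a) ` S) \<Longrightarrow> norm z < e \<Longrightarrow> a + z \<in> rel_interior S"
proof -
  have aS: "a \<in> S" using assms rel_interior_subset by blast
  obtain T where T: "open T" "a \<in> T" "T \<inter> affine hull S \<subseteq> S"
    using assms mem_rel_interior by blast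
  obtain e where e: "e > 0" "ball a e \<subseteq> T" using T open_contains_ball by blast
  show ?thesis
  proof
    show "e > 0" by fact
    fix z assume z: "z \<in> span ((\<lambda>s. s - a) ` S)" "norm z < e"
    have "a + z \<in> affine hull S"
      using z(1) aS affine_hull_span_gen[of a S] by (auto simp: hull_inc)
    moreover have "a + z \<in> T" using z(2) e by (auto simp: dist_norm)
    ultimately show "a + z \<in> rel_interior S"
      using T mem_rel_interior by blast
  qed
qed

text \<open>Near a relative interior point the subdifferential coincides with its affine hull. All
  directions of the V-space are then available with both signs, so regular normals annihilate them,
  and so do limits of such normals.\<close>

lemma U_space_eq_orthogonal_comp:
  assumes g: "g \<in> rel_interior (limiting_subdiff f x)"
  shows "U_space f x g = (V_space f x g)\<^sup>\<bottom>"
proof (intro equalityI subsetI)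
  let ?S = "limiting_subdiff f x"
  have gS: "g \<in> ?S" using g rel_interior_subset by blast
  have reg: "w \<in> (V_space f x g)\<^sup>\<bottom>" if w: "w \<in> regular_normal_cone ?S y" and y: "y \<in> rel_interior ?S"
    for w y
  proof -
    have yS: "y \<in> ?S" using y rel_interior_subset by blast
    obtain r where r: "r > 0"
      "\<And>z. z \<in> V_space f x y \<Longrightarrow> norm z < r \<Longrightarrow> y + z \<in> rel_interior ?S"
      using rel_interior_add_span[OF y] unfolding V_space_def by metis
    have le: "w \<bullet> z \<le> 0" if z: "z \<in> V_space f x y" for z
    proof (cases "z = 0")
      case False
      have "w \<bullet> z \<le> e * norm z" if "e > 0" for e :: real
      proof -
        obtain d where d: "d > 0"
          "\<And>y'. y' \<in> ?S \<Longrightarrow> y' \<noteq> y \<Longrightarrow> dist y' y < d \<Longrightarrow> w \<bullet> (y' - y) \<le> e * norm (y' - y)"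
          using w \<open>e > 0\<close> unfolding regular_normal_cone_def eventually_at by blast
        \<comment> \<open>The scaled step stays in the relative ball of radius \<open>r\<close> and
          within the range \<open>d\<close> of the normal inequality.\<close>
        define t where "t = min r d / (2 * norm z)"
        have t: "t > 0" "norm (t *\<^sub>R z) < r" "norm (t *\<^sub>R z) < d"
          using r d False by (auto simp: t_def)
        have "t *\<^sub>R z \<in> V_space f x y"
          using z unfolding V_space_def by (rule span_scale)
        then have "y + t *\<^sub>R z \<in> ?S" using r(2) t(2) rel_interior_subset by blast
        then have "w \<bullet> (t *\<^sub>R z) \<le> e * norm (t *\<^sub>R z)"
          using d(2)[of "y + t *\<^sub>R z"] t False by (simp add: dist_norm)
        then show ?thesis using t(1) by simp
      qed
      \<comment> \<open>With this \<open>e\<close> a positive \<open>w \<bullet> z\<close> would be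
        at most half of itself.\<close>
      from this[of "w \<bullet> z / (2 * norm z)"] show ?thesis
        using False by (cases "w \<bullet> z > 0") auto
    qed simp
    have "w \<bullet> z = 0" if z: "z \<in> V_space f x y" for z
    proof -
      have "- z \<in> V_space f x y" using z unfolding V_space_def by (rule span_neg)
      from le[OF z] le[OF this] show ?thesis by simp
    qed
    then show ?thesis
      using span_diff_base_eq[OF gS yS]
      by (auto simp: orthogonal_comp_def orthogonal_def V_space_def inner_commute)
  qed
  fix w assume "w \<in> U_space f x g"
  then obtain X G where X: "X \<longlonglongrightarrow> g" and G: "G \<longlonglongrightarrow> w"
    and XS: "\<And>k. X k \<in> ?S" and GN: "\<And>k. G k \<in> regular_normal_cone ?S (X k)"
    unfolding U_space_def limiting_normal_cone_def by blast
  \<comment> \<open>The points \<open>X k\<close> are only known to lie in the subdifferential;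
    those inside \<open>T\<close> lie in its relative interior.\<close>
  obtain T where T: "open T" "g \<in> T" "T \<inter> affine hull ?S \<subseteq> ?S"
    using g mem_rel_interior by blast
  have "\<forall>\<^sub>F k in sequentially. X k \<in> T" using X T by (simp add: topological_tendstoD)
  then have "\<forall>\<^sub>F k in sequentially. G k \<in> (V_space f x g)\<^sup>\<bottom>"
  proof eventually_elim
    case (elim k)
    then have "X k \<in> rel_interior ?S" using XS[of k] T mem_rel_interior by blast
    then show ?case by (rule reg[OF GN])
  qed
  then show "w \<in> (V_space f x g)\<^sup>\<bottom>"
    using Lim_in_closed_set[OF closed_subspace[OF subspace_orthogonal_comp] _ _ G] by simp
next
  let ?S = "limiting_subdiff f x"
  have gS: "g \<in> ?S" using g rel_interior_subset by blast
  fix w assume w: "w \<in> (V_space f x g)\<^sup>\<bottom>"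
  have "w \<bullet> (y - g) = 0" if "y \<in> ?S" for y
  proof -
    have "y - g \<in> V_space f x g" using that unfolding V_space_def by (auto intro: span_base)
    then show ?thesis using w by (auto simp: orthogonal_comp_def orthogonal_def inner_commute)
  qed
  then have reg: "w \<in> regular_normal_cone ?S g"
    using gS unfolding regular_normal_cone_def eventually_at
    using zero_less_one by fastforce
  show "w \<in> U_space f x g"
    unfolding U_space_def limiting_normal_cone_def mem_Collect_eq
    by (intro conjI exI[of _ "\<lambda>_. g"] exI[of _ "\<lambda>_. w"] allI gS reg tendsto_const)
qed

section \<open>Basis matrices, projections and coordinate changes\<close>

lemma range_matrix_vector_mult:
  fixes A :: "real^'k^'n"
  shows "range ((*v) A) = span (columns A)"
proof
  show "range ((*v) A) \<subseteq> span (columns A)"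
    using matrix_vector_mult_in_columnspace by blast
  show "span (columns A) \<subseteq> range ((*v) A)"
    by (rule span_minimal)
      (auto simp: columns_image_basis intro!: linear_subspace_image)
qed

text \<open>The zero matrix standing for the empty basis also has the right range, so later
  arguments treat all dimensions of the subspace at once.\<close>

lemma basis_matrix_range:
  fixes A :: "real^'k^'n"
  assumes "basis_matrix A S"
  shows "range ((*v) A) = S"
  using assms by (cases "S = {0}") (auto simp: basis_matrix_def range_matrix_vector_mult)

lemma orthonormal_basis_matrix_range:
  fixes A :: "real^'k^'n"
  assumes "orthonormal_basis_matrix A S"
  shows "range ((*v) A) = S"
  using assms by (cases "S = {0}") (auto simp: orthonormal_basis_matrix_def range_matrix_vector_mult)

lemma inner_matrix_vector_mult_transpose:
  fixes A :: "real^'k^'n"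
  shows "(A *v x) \<bullet> y = x \<bullet> (transpose A *v y)"
  by (metis dot_lmul_matrix inner_commute transpose_matrix_vector)

text \<open>Orthonormal columns give \<open>transpose U ** U = mat 1\<close>, which makes
  \<open>U ** transpose U\<close> the orthogonal projection onto \<open>S\<close>. The identity
  fails for the zero matrix representing the basis of \<open>{0}\<close>, but there the complement
  is the whole space.\<close>

lemma orthonormal_basis_matrix_residual:
  fixes U :: "real^'k^'n"
  assumes U: "orthonormal_basis_matrix U S"
  shows "h - U *v (transpose U *v h) \<in> S\<^sup>\<bottom>"
proof (cases "S = {0}")
  case False
  then have "\<And>i j. column i U \<bullet> column j U = (if i = j then 1 else 0)"
    using U by (auto simp: orthonormal_basis_matrix_def)
  then have UU: "transpose U ** U = mat 1"
    by (auto simp: vec_eq_iff matrix_matrix_mult_def transpose_def mat_def column_def inner_vec_def)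
  have "s \<bullet> (h - U *v (transpose U *v h)) = 0" if "s \<in> S" for s
  proof -
    obtain x where "s = U *v x"
      using \<open>s \<in> S\<close> orthonormal_basis_matrix_range[OF U] by blast
    then show ?thesis
      by (simp add: inner_matrix_vector_mult_transpose matrix_vector_mult_diff_distrib
          matrix_vector_mul_assoc matrix_mul_assoc UU)
  qed
  then show ?thesis by (simp add: orthogonal_comp_def orthogonal_def)
qed simp

lemma matrix_factor_through_range:
  fixes M :: "real^'k^'n" and N :: "real^'l^'n"
  assumes "range ((*v) N) \<subseteq> range ((*v) M)"
  obtains A where "N = M ** A"
proof -
  have "\<forall>k. \<exists>a. M *v a = N *v axis k 1" using assms by (metis imageE range_eqI subsetD)
  then obtain a where a: "\<And>k. M *v a k = column k N"
    by (metis matrix_vector_mult_basis)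
  have "N = M ** (\<chi> j k. a k $ j)"
    using a by (simp add: vec_eq_iff matrix_matrix_mult_def matrix_vector_mult_def column_def)
  then show ?thesis by (rule that)
qed

text \<open>For two basis matrices of the V-space, \<open>A\<close> and \<open>B\<close> are the
  coordinate changes that carry minimisers from the basis of the fast track to the one chosen for
  \<open>f\<close>.\<close>

lemma range_eq_imp_matrix_factors:
  fixes M :: "real^'k^'n" and N :: "real^'l^'n"
  assumes "range ((*v) M) = range ((*v) N)"
  obtains A B where "N = M ** A" "M = N ** B"
  using matrix_factor_through_range[of N M] matrix_factor_through_range[of M N] assms
  by (metis order_refl)

section \<open>Finite norming sets\<close>

text \<open>An orthonormal basis scaled by \<open>e/2\<close> with both signs, together with 0, does
  it: if no pairing were large, the coordinates of \<open>y\<close> would be too small to add up to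
  \<open>norm y\<close>. Finiteness of \<open>Z\<close> later allows the neighbourhoods belonging to
  its elements to be intersected.\<close>

lemma subspace_finite_norming_set:
  fixes W :: "'a::euclidean_space set"
  assumes W: "subspace W" and e: "e > 0"
  obtains Z c where "finite Z" "Z \<subseteq> W" "\<And>z. z \<in> Z \<Longrightarrow> norm z < e" "(c::real) > 0"
    "\<And>y. y \<in> W \<Longrightarrow> \<exists>z\<in>Z. c * norm y \<le> z \<bullet> y"
proof -
  obtain B where B: "B \<subseteq> W" "pairwise orthogonal B" "\<And>x. x \<in> B \<Longrightarrow> norm x = 1"
      "independent B" "span B = W"
    using orthonormal_basis_subspace[OF W] by metis
  have fin: "finite B" using B(4) by (rule independent_imp_finite)
  \<comment> \<open>Including 0 settles \<open>y = 0\<close>, in particular the case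
    \<open>W = {0}\<close> with its empty basis.\<close>
  define Z where "Z = insert 0 ((\<lambda>b. (e/2) *\<^sub>R b) ` B \<union> (\<lambda>b. (-e/2) *\<^sub>R b) ` B)"
  \<comment> \<open>The \<open>+ 1\<close> makes the final sum strictly smaller than
    \<open>norm y\<close> and keeps the divisor positive for an empty basis.\<close>
  define c where "c = e / 2 / (card B + 1)"
  show ?thesis
  proof
    show "finite Z" using fin by (simp add: Z_def)
    show "Z \<subseteq> W" using B(1) W by (auto simp: Z_def subspace_0 intro: subspace_scale subspace_neg)
    show "norm z < e" if "z \<in> Z" for z using that e B(3) by (auto simp: Z_def)
    show "c > 0" using e by (simp add: c_def)
    fix y assume y: "y \<in> W"
    show "\<exists>z\<in>Z. c * norm y \<le> z \<bullet> y"
    proof (rule ccontr)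
      assume "\<not> ?thesis"
      then have less: "z \<bullet> y < c * norm y" if "z \<in> Z" for z using that by force
      have "norm y > 0" using less[of 0] \<open>c > 0\<close> by (simp add: Z_def zero_less_mult_iff)
      have abs: "\<bar>y \<bullet> b\<bar> \<le> norm y / (card B + 1)" if "b \<in> B" for b
      proof -
        have c: "c * norm y = e/2 * (norm y / (card B + 1))" by (simp add: c_def)
        have "e/2 * (b \<bullet> y) < c * norm y" "e/2 * (- (b \<bullet> y)) < c * norm y"
          using less[of "(e/2) *\<^sub>R b"] less[of "(-e/2) *\<^sub>R b"] that by (auto simp: Z_def)
        then have "b \<bullet> y < norm y / (card B + 1)" "- (b \<bullet> y) < norm y / (card B + 1)"
          using e unfolding c by (simp_all only: mult_less_cancel_left_pos half_gt_zero)
        then show ?thesis by (simp add: inner_commute)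
      qed
      have "norm y = norm (\<Sum>b\<in>B. (y \<bullet> b) *\<^sub>R b)"
        using orthonormal_basis_expand[OF B(2,3)] y B(5) fin by simp
      also have "\<dots> \<le> (\<Sum>b\<in>B. norm y / (card B + 1))"
        using abs B(3) by (intro sum_norm_le) simp
      also have "\<dots> < norm y" using \<open>norm y > 0\<close> by (simp add: field_simps)
      finally show False by simp
    qed
  qed
qed

section \<open>The U-Lagrangian along a fast track\<close>

lemma GDERIV_cong_eventually:
  assumes "\<forall>\<^sub>F u in nhds x. f u = g u"
  shows "GDERIV f x :> D \<longleftrightarrow> GDERIV g x :> D"
proof -
  have "\<forall>\<^sub>F u in at x. f u = g u" "f x = g x"
    using assms by (auto simp: eventually_nhds_conv_at)
  then show ?thesis
    unfolding gderiv_def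
    by (auto elim!: has_derivative_transform_eventually simp: eq_commute)
qed

lemma U_Lagrangian_eq_objective:
  assumes "v \<in> U_minimizers \<epsilon> f xb U V g u"
  shows "U_Lagrangian \<epsilon> f xb U V g u = U_objective f xb U V g u v"
  using assms unfolding U_minimizers_def U_Lagrangian_def
  by (intro antisym INF_lower INF_greatest) auto

text \<open>Along minimisers the U-Lagrangian is the same real function for all small \<epsilon>, on
  neighbourhoods of 0 that may depend on \<epsilon>. A gradient at 0 sees only the germ, so the
  quantifier over \<epsilon> disappears.\<close>

lemma Lagrangian_gradient_iff:
  assumes min: "\<forall>\<^sub>F \<epsilon> in at_right 0. \<forall>\<^sub>F u in nhds 0. w u \<in> U_minimizers \<epsilon> f xb U V g u"
    and \<pi>: "\<forall>\<^sub>F u in nhds 0. f (xb + U *v u + V *v w u) = ereal (\<pi> u)"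
  shows "Lagrangian_gradient f xb U V g D \<longleftrightarrow> GDERIV (\<lambda>u. \<pi> u - g \<bullet> (V *v w u)) 0 :> D"
proof -
  let ?L = "\<lambda>u. \<pi> u - g \<bullet> (V *v w u)"
  have L: "\<forall>\<^sub>F \<epsilon> in at_right 0. \<forall>\<^sub>F u in nhds 0. U_Lagrangian \<epsilon> f xb U V g u = ereal (?L u)"
    using min
  proof eventually_elim
    case (elim \<epsilon>)
    from elim \<pi> show ?case
      by eventually_elim (simp add: U_Lagrangian_eq_objective U_objective_def)
  qed
  show ?thesis
  proof
    assume "Lagrangian_gradient f xb U V g D"
    from eventually_happens'[OF trivial_limit_at_right_real
        eventually_conj[OF this[unfolded Lagrangian_gradient_def] L]]
    obtain \<epsilon> where "\<exists>l. (\<forall>\<^sub>F u in nhds 0. U_Lagrangian \<epsilon> f xb U V g u = ereal (l u)) \<and> GDERIV l 0 :> D"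
      "\<forall>\<^sub>F u in nhds 0. U_Lagrangian \<epsilon> f xb U V g u = ereal (?L u)"
      by blast
    then obtain l where "\<forall>\<^sub>F u in nhds 0. U_Lagrangian \<epsilon> f xb U V g u = ereal (l u)" "GDERIV l 0 :> D"
      "\<forall>\<^sub>F u in nhds 0. U_Lagrangian \<epsilon> f xb U V g u = ereal (?L u)" by blast
    moreover from this have "\<forall>\<^sub>F u in nhds 0. l u = ?L u"
      by (auto elim: eventually_elim2)
    ultimately show "GDERIV ?L 0 :> D" using GDERIV_cong_eventually[of l ?L 0 D] by simp
  next
    assume "GDERIV ?L 0 :> D"
    then show "Lagrangian_gradient f xb U V g D"
      unfolding Lagrangian_gradient_def using L by (auto elim: eventually_mono)
  qed
qed

text \<open>The function \<open>v\<close> is common to all parameters \<open>g\<close>. Hence the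
  values of \<open>p\<close> along the track form a single germ \<pi>, which can be read off from
  one \<open>g\<close> and one radius.\<close>

lemma fast_track_local_minimizers:
  assumes track: "fast_track p xb M d U V track"
    and ne: "rel_interior (limiting_subdiff p xb) \<noteq> {}"
  obtains v \<pi> where "v 0 = 0" "v differentiable (at 0)" "\<pi> differentiable (at (0::real^'u))"
    "\<forall>\<^sub>F u in nhds 0. p (xb + U *v u + V *v v u) = ereal (\<pi> u)"
    "\<And>g. g \<in> rel_interior (limiting_subdiff p xb) \<Longrightarrow>
       \<forall>\<^sub>F \<epsilon> in at_right 0. \<forall>\<^sub>F u in nhds 0. v u \<in> U_minimizers \<epsilon> p xb U V g u"
proof -
  obtain v where v: "\<And>g. g \<in> rel_interior (limiting_subdiff p xb) \<Longrightarrow> \<forall>\<^sub>F \<epsilon> in at_right 0. \<exists>r>0.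
         C2_on (ball 0 r) v \<and>
         (\<forall>u \<in> ball 0 r. v u \<in> U_minimizers \<epsilon> p xb U V g u) \<and>
         (\<exists>l :: real^'u \<Rightarrow> real. C2_on (ball 0 r) l \<and>
            (\<forall>u \<in> ball 0 r. U_Lagrangian \<epsilon> p xb U V g u = ereal (l u)))"
    using track unfolding fast_track_def by blast
  obtain g where g: "g \<in> rel_interior (limiting_subdiff p xb)" using ne by blast
  obtain b where "b > 0" and b: "\<And>\<epsilon>. 0 < \<epsilon> \<Longrightarrow> \<epsilon> < b \<Longrightarrow> \<exists>r>0.
         C2_on (ball 0 r) v \<and>
         (\<forall>u \<in> ball 0 r. v u \<in> U_minimizers \<epsilon> p xb U V g u) \<and>
         (\<exists>l :: real^'u \<Rightarrow> real. C2_on (ball 0 r) l \<and>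
            (\<forall>u \<in> ball 0 r. U_Lagrangian \<epsilon> p xb U V g u = ereal (l u)))"
    using v[OF g] unfolding eventually_at_right_field by auto
  obtain r l where r: "r > 0" and C2: "C2_on (ball 0 r) v" "C2_on (ball 0 r) l"
    and min: "\<And>u. u \<in> ball 0 r \<Longrightarrow> v u \<in> U_minimizers (b/2) p xb U V g u"
    and l: "\<And>u. u \<in> ball 0 r \<Longrightarrow> U_Lagrangian (b/2) p xb U V g u = ereal (l u)"
    using b[of "b/2"] \<open>b > 0\<close> by auto
  show ?thesis
  proof
    \<comment> \<open>As a minimiser, \<open>v 0\<close> lies in every sufficiently small ball, so a
      radius below \<open>norm (v 0)\<close> is contradictory.\<close>
    show "v 0 = 0"
    proof (rule ccontr)
      assume "v 0 \<noteq> 0"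
      then have "0 < min b (norm (v 0)) / 2" "min b (norm (v 0)) / 2 < b"
        using \<open>b > 0\<close> by (auto simp: min_def)
      from b[OF this] obtain r where "r > 0"
        "\<forall>u\<in>ball 0 r. v u \<in> U_minimizers (min b (norm (v 0)) / 2) p xb U V g u" by blast
      then have "norm (v 0) \<le> min b (norm (v 0)) / 2"
        by (auto simp: U_minimizers_def dest: bspec[of _ _ 0])
      moreover have "norm (v 0) > 0" using \<open>v 0 \<noteq> 0\<close> by simp
      ultimately show False by linarith
    qed
    show dv: "v differentiable (at 0)"
      using C2_on_imp_differentiable[OF C2(1)] r by simp
    \<comment> \<open>Undoing the tilt by \<open>g\<close> in the U-Lagrangian \<open>l\<close>
      recovers the values of \<open>p\<close>, so this is the witness for \<pi>.\<close>
    show "(\<lambda>u. l u + g \<bullet> (V *v v u)) differentiable (at 0)"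
    proof -
      have "((\<bullet>) g \<circ> (*v) V) differentiable (at (v 0))"
        by (intro differentiable_chain_at linear_imp_differentiable bounded_linear_imp_differentiable bounded_linear_inner_right) auto
      from differentiable_chain_at[OF dv this] show ?thesis
        using C2_on_imp_differentiable[OF C2(2), of 0] r
        by (intro differentiable_add) (auto simp: o_def)
    qed
    show "\<forall>\<^sub>F u in nhds 0. p (xb + U *v u + V *v v u) = ereal (l u + g \<bullet> (V *v v u))"
      unfolding eventually_nhds_metric
    proof (intro exI[of _ r] conjI allI impI r)
      fix u :: "real^'u" assume "dist u 0 < r"
      then have "U_objective p xb U V g u (v u) = ereal (l u)"
        using U_Lagrangian_eq_objective[OF min] l by (metis dist_commute mem_ball)
      then show "p (xb + U *v u + V *v v u) = ereal (l u + g \<bullet> (V *v v u))"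
        unfolding U_objective_def by (cases "p (xb + U *v u + V *v v u)") (auto simp: algebra_simps)
    qed
    show "\<forall>\<^sub>F \<epsilon> in at_right 0. \<forall>\<^sub>F u in nhds 0. v u \<in> U_minimizers \<epsilon> p xb U V g u"
      if "g \<in> rel_interior (limiting_subdiff p xb)" for g
      using v[OF that]
    proof eventually_elim
      case (elim \<epsilon>)
      then show ?case unfolding eventually_nhds_metric by (auto simp: dist_commute)
    qed
  qed
qed

section \<open>Sharp minimality and smooth perturbations\<close>

text \<open>The mean value inequality is applied to \<open>q\<close> minus its linearisation at
  \<open>a\<close>; continuity of \<open>grad q\<close> bounds the gradient of this difference by
  \<open>c\<close> on a small ball.\<close>

lemma C2_near_linear:
  fixes q :: "'a::euclidean_space \<Rightarrow> real"
  assumes q: "C2_on S q" and a: "a \<in> S" and c: "c > 0"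
  obtains \<rho> where "\<rho> > 0"
    "\<And>x y. x \<in> ball a \<rho> \<Longrightarrow> y \<in> ball a \<rho> \<Longrightarrow> \<bar>q y - q x - grad q a \<bullet> (y - x)\<bar> \<le> c * norm (y - x)"
proof -
  have S: "open S" using q by (simp add: C2_on_def)
  have "isCont (grad q) a"
    using continuous_on_grad[OF q] S a by (simp add: continuous_on_eq_continuous_at)
  then obtain d where d: "d > 0" "\<And>x. dist x a < d \<Longrightarrow> dist (grad q x) (grad q a) < c"
    using c unfolding continuous_at_eps_delta by blast
  obtain e where e: "e > 0" "ball a e \<subseteq> S" using S a open_contains_ball by blast
  define \<rho> where "\<rho> = min d e"
  have \<rho>: "\<rho> > 0" using d e by (simp add: \<rho>_def)
  have "norm ((q y - grad q a \<bullet> y) - (q x - grad q a \<bullet> x)) \<le> c * norm (y - x)"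
    if xy: "x \<in> ball a \<rho>" "y \<in> ball a \<rho>" for x y
  proof (rule differentiable_bound[OF convex_ball _ _ xy(2,1)])
    fix z assume z: "z \<in> ball a \<rho>"
    then have "z \<in> S" using e by (auto simp: \<rho>_def)
    then have "(q has_derivative (\<lambda>h. h \<bullet> grad q z)) (at z within ball a \<rho>)"
      using C2_on_GDERIV[OF q] has_derivative_at_withinI unfolding gderiv_def by blast
    then show "((\<lambda>y. q y - grad q a \<bullet> y) has_derivative (\<lambda>h. h \<bullet> (grad q z - grad q a))) (at z within ball a \<rho>)"
      by (auto simp: inner_diff_right inner_commute[of "grad q a"] intro!: derivative_eq_intros)
    have c: "norm (grad q z - grad q a) \<le> c"
      using d(2)[of z] z by (simp add: \<rho>_def dist_norm norm_minus_commute less_imp_le)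
    have "norm (h \<bullet> (grad q z - grad q a)) \<le> c * norm h" for h
    proof -
      have "norm (h \<bullet> (grad q z - grad q a)) \<le> norm h * norm (grad q z - grad q a)"
        by (simp add: Cauchy_Schwarz_ineq2)
      also have "\<dots> \<le> norm h * c" using c by (simp add: mult_left_mono)
      finally show ?thesis by (simp add: mult.commute)
    qed
    then show "onorm (\<lambda>h. h \<bullet> (grad q z - grad q a)) \<le> c"
      by (rule onorm_le)
  qed
  then show ?thesis using \<rho> by (intro that) (auto simp: inner_diff_right algebra_simps)
qed

lemma matrix_vector_mult_small:
  fixes A :: "real^'k^'n"
  assumes "e > 0"
  obtains d where "d > 0" "\<And>w. norm w < d \<Longrightarrow> norm (A *v w) < e"
proof -
  have "isCont ((*v) A) 0" by (intro linear_continuous_at) simp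
  then show ?thesis
    using that assms unfolding continuous_at_eps_delta by (auto simp: dist_norm)
qed

text \<open>The fast track minimises for every dual parameter \<open>g + z\<close> in the relative interior;
  comparing finitely many such \<open>z\<close> turns minimality into linear growth along the V-space.\<close>

lemma U_minimizers_sharp:
  assumes g: "g \<in> rel_interior (limiting_subdiff p xb)"
    and V: "range ((*v) V) = V_space p xb g"
    and \<pi>: "\<forall>\<^sub>F u in nhds 0. p (xb + U *v u + V *v v u) = ereal (\<pi> u)"
    and min: "\<And>g. g \<in> rel_interior (limiting_subdiff p xb) \<Longrightarrow>
       \<forall>\<^sub>F \<epsilon> in at_right 0. \<forall>\<^sub>F u in nhds 0. v u \<in> U_minimizers \<epsilon> p xb U V g u"
  obtains c where "c > 0" "\<forall>\<^sub>F \<epsilon> in at_right 0. \<forall>\<^sub>F u in nhds 0. \<forall>w\<in>cball 0 \<epsilon>.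
     ereal (\<pi> u + g \<bullet> (V *v w - V *v v u) + c * norm (V *v w - V *v v u)) \<le> p (xb + U *v u + V *v w)"
proof -
  obtain e where "e > 0" and
    e: "\<And>z. z \<in> V_space p xb g \<Longrightarrow> norm z < e \<Longrightarrow> g + z \<in> rel_interior (limiting_subdiff p xb)"
    using rel_interior_add_span[OF g] unfolding V_space_def by metis
  have sub: "subspace (V_space p xb g)" by (simp add: V_space_def)
  obtain Z c where Z: "finite Z" "Z \<subseteq> V_space p xb g" "\<And>z. z \<in> Z \<Longrightarrow> norm z < e" and "c > 0"
    and c: "\<And>y. y \<in> V_space p xb g \<Longrightarrow> \<exists>z\<in>Z. c * norm y \<le> z \<bullet> y"
    using subspace_finite_norming_set[OF sub \<open>e > 0\<close>] by metis
  \<comment> \<open>Finiteness of \<open>Z\<close> gives one threshold for \<epsilon> here and one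
    neighbourhood of 0 for \<open>u\<close> below.\<close>
  have "\<forall>\<^sub>F \<epsilon> in at_right 0. \<forall>z\<in>Z. \<forall>\<^sub>F u in nhds 0. v u \<in> U_minimizers \<epsilon> p xb U V (g + z) u"
    using Z e min by (intro eventually_ball_finite) blast+
  then have "\<forall>\<^sub>F \<epsilon> in at_right 0. \<forall>\<^sub>F u in nhds 0. \<forall>w\<in>cball 0 \<epsilon>.
     ereal (\<pi> u + g \<bullet> (V *v w - V *v v u) + c * norm (V *v w - V *v v u)) \<le> p (xb + U *v u + V *v w)"
  proof eventually_elim
    case (elim \<epsilon>)
    then have "\<forall>\<^sub>F u in nhds 0. \<forall>z\<in>Z. v u \<in> U_minimizers \<epsilon> p xb U V (g + z) u"
      using Z(1) by (intro eventually_ball_finite) blast+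
    with \<pi> show ?case
    proof eventually_elim
      case (elim u)
      show ?case
      proof
        fix w :: "real^'b" assume w: "w \<in> cball 0 \<epsilon>"
        have "V *v w - V *v v u \<in> V_space p xb g"
          using V sub by (metis rangeI subspace_diff)
        \<comment> \<open>Passing from \<open>g\<close> to \<open>g + z\<close> tilts the objective
          by the pairing of \<open>z\<close> with the displacement; for this \<open>z\<close> the
          pairing is at least the growth term.\<close>
        then obtain z where z: "z \<in> Z" "c * norm (V *v w - V *v v u) \<le> z \<bullet> (V *v w - V *v v u)"
          using c by blast
        have "U_objective p xb U V (g + z) u (v u) \<le> U_objective p xb U V (g + z) u w"
          using elim(2) z(1) w unfolding U_minimizers_def by blast
        then show "ereal (\<pi> u + g \<bullet> (V *v w - V *v v u) + c * norm (V *v w - V *v v u))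
            \<le> p (xb + U *v u + V *v w)"
          using elim(1) z(2) unfolding U_objective_def
          by (cases "p (xb + U *v u + V *v w)") (auto simp: inner_add_left inner_diff_right)
      qed
    qed
  qed
  with \<open>c > 0\<close> show ?thesis by (rule that)
qed

text \<open>The linear growth of \<open>p\<close> off the track dominates the error of linearising
  \<open>q\<close>. The matrices \<open>A\<close> and \<open>B\<close> translate between the
  coordinates of \<open>V\<close>, where the growth is known, and those of \<open>Vf\<close>, where
  minimality is claimed.\<close>

lemma U_minimizers_add_smooth:
  fixes V :: "real^'v^'n" and Vf :: "real^'k^'n"
  assumes f: "\<And>x. f x = p x + ereal (q x)" and q: "C2_on UNIV q"
    and g: "g \<in> rel_interior (limiting_subdiff p xb)"
    and V: "range ((*v) V) = V_space p xb g"
    and v: "v 0 = 0" "isCont v 0"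
    and \<pi>: "\<forall>\<^sub>F u in nhds 0. p (xb + U *v u + V *v v u) = ereal (\<pi> u)"
    and min: "\<And>g. g \<in> rel_interior (limiting_subdiff p xb) \<Longrightarrow>
       \<forall>\<^sub>F \<epsilon> in at_right 0. \<forall>\<^sub>F u in nhds 0. v u \<in> U_minimizers \<epsilon> p xb U V g u"
    and A: "Vf = V ** A" and B: "V = Vf ** B"
  shows "\<forall>\<^sub>F \<epsilon> in at_right 0. \<forall>\<^sub>F u in nhds 0.
    B *v v u \<in> U_minimizers \<epsilon> f xb U Vf (grad q xb + g) u"
proof -
  obtain c where "c > 0" and sharp: "\<forall>\<^sub>F \<epsilon> in at_right 0. \<forall>\<^sub>F u in nhds 0. \<forall>w\<in>cball 0 \<epsilon>.
     ereal (\<pi> u + g \<bullet> (V *v w - V *v v u) + c * norm (V *v w - V *v v u)) \<le> p (xb + U *v u + V *v w)"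
    using U_minimizers_sharp[OF g V \<pi> min] by blast
  \<comment> \<open>Taking the growth constant \<open>c\<close> as the Lipschitz bound makes the two
    norm terms cancel when the inequalities are added.\<close>
  obtain \<rho> where "\<rho> > 0" and
    \<rho>: "\<And>x y. x \<in> ball xb \<rho> \<Longrightarrow> y \<in> ball xb \<rho> \<Longrightarrow> \<bar>q y - q x - grad q xb \<bullet> (y - x)\<bar> \<le> c * norm (y - x)"
    using C2_near_linear[OF q UNIV_I \<open>c > 0\<close>] by metis
  \<comment> \<open>One half of \<rho> is reserved for the V-part of a point, the other for its
    U-part.\<close>
  obtain dV where dV: "dV > 0" "\<And>w. norm w < dV \<Longrightarrow> norm (V *v w) < \<rho> / 2"
    using matrix_vector_mult_small[of "\<rho>/2"] \<open>\<rho> > 0\<close> by (metis half_gt_zero)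
  obtain \<epsilon>0 where \<epsilon>0: "\<epsilon>0 > 0" "\<epsilon>0 < dV" and sharp0: "\<forall>\<^sub>F u in nhds 0. \<forall>w\<in>cball 0 \<epsilon>0.
     ereal (\<pi> u + g \<bullet> (V *v w - V *v v u) + c * norm (V *v w - V *v v u)) \<le> p (xb + U *v u + V *v w)"
    using eventually_happens'[OF trivial_limit_at_right_real
        eventually_conj[OF eventually_at_right_less eventually_conj[OF eventually_at_right_real[OF dV(1)] sharp]]]
    by auto
  \<comment> \<open>One radius \<open>\<epsilon>0\<close> suffices: \<open>A\<close> maps the
    \<open>Vf\<close>-coordinates of norm below \<open>dA\<close> into that ball, so the growth
    holds for every \<epsilon> below \<open>dA\<close>.\<close>
  obtain dA where dA: "dA > 0" "\<And>w. norm w < dA \<Longrightarrow> norm (A *v w) < \<epsilon>0"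
    using matrix_vector_mult_small[OF \<epsilon>0(1)] by metis
  have lim_v: "(v \<longlongrightarrow> 0) (nhds 0)"
    using v by (metis isCont_def tendsto_at_iff_tendsto_nhds)
  have "isCont (\<lambda>u. B *v v u) 0"
    by (intro isCont_o2[OF v(2)] linear_continuous_at) simp
  then have lim_B: "((\<lambda>u. B *v v u) \<longlongrightarrow> 0) (nhds 0)"
    using v(1) tendsto_at_iff_tendsto_nhds[of "\<lambda>u. B *v v u" 0] by (simp add: isCont_def)
  have "isCont ((*v) U) 0" by (intro linear_continuous_at) simp
  then have lim_U: "((*v) U \<longlongrightarrow> 0) (nhds 0)"
    using tendsto_at_iff_tendsto_nhds[of "(*v) U" 0] by (simp add: isCont_def)
  show ?thesis
    unfolding eventually_at_right_field
  proof (intro exI[of _ dA] conjI allI impI dA(1))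
    fix \<epsilon> assume \<epsilon>: "0 < \<epsilon>" "\<epsilon> < dA"
    have "\<forall>\<^sub>F u in nhds 0. norm (B *v v u) < \<epsilon>" "\<forall>\<^sub>F u in nhds 0. norm (U *v u) < \<rho> / 2"
      "\<forall>\<^sub>F u in nhds 0. norm (v u) < dV"
      using tendstoD[OF lim_B \<epsilon>(1)] tendstoD[OF lim_U, of "\<rho>/2"] tendstoD[OF lim_v dV(1)] \<open>\<rho> > 0\<close>
      by (simp_all add: dist_norm)
    with sharp0 \<pi> show "\<forall>\<^sub>F u in nhds 0. B *v v u \<in> U_minimizers \<epsilon> f xb U Vf (grad q xb + g) u"
    proof eventually_elim
      case (elim u)
      have "U_objective f xb U Vf (grad q xb + g) u (B *v v u) \<le> U_objective f xb U Vf (grad q xb + g) u w"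
        if w: "w \<in> cball 0 \<epsilon>" for w
      proof -
        let ?x = "xb + U *v u + V *v v u" and ?y = "xb + U *v u + V *v (A *v w)"
        have Aw: "norm (A *v w) < \<epsilon>0" using dA(2)[of w] w \<epsilon> by simp
        have "norm (U *v u + V *v v u) < \<rho>"
          using norm_triangle_ineq[of "U *v u" "V *v v u"] elim(4) dV(2)[OF elim(5)] by linarith
        moreover have "norm (U *v u + V *v (A *v w)) < \<rho>"
          using norm_triangle_ineq[of "U *v u" "V *v (A *v w)"] elim(4) dV(2)[of "A *v w"] Aw \<epsilon>0(2)
          by linarith
        moreover have "a \<in> ball xb \<rho>" if "a = xb + b" "norm b < \<rho>" for a b :: "real^'n"
          using that by (simp add: dist_norm)
        ultimately have "?x \<in> ball xb \<rho>" "?y \<in> ball xb \<rho>"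
          by (metis add.assoc)+
        from \<rho>[OF this]
        have "q ?x - grad q xb \<bullet> (V *v v u)
           \<le> q ?y - grad q xb \<bullet> (V *v (A *v w)) + c * norm (V *v (A *v w) - V *v v u)"
          by (simp add: inner_diff_right)
        moreover have "ereal (\<pi> u + g \<bullet> (V *v (A *v w) - V *v v u) + c * norm (V *v (A *v w) - V *v v u))
            \<le> p ?y"
          using elim(1) Aw by simp
        moreover have "Vf *v w = V *v (A *v w)" "Vf *v (B *v v u) = V *v v u"
          by (simp_all add: matrix_vector_mul_assoc flip: A B)
        ultimately show ?thesis
          using elim(2) unfolding U_objective_def f
          by (cases "p ?y") (auto simp: inner_add_left inner_diff_right)
      qed
      then show ?case using elim(3) by (auto simp: U_minimizers_def)
    qed
  qed
qed

section \<open>The U-gradient as a projected subgradient\<close>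

text \<open>\<open>U *v D + g - U *v (transpose U *v g)\<close> is a regular subgradient, so it differs from \<open>g\<close> by
  an element of the V-space; that difference also lies in the U-space, hence vanishes.\<close>

lemma U_gradient_fast_track:
  fixes U :: "real^'u^'n" and V :: "real^'v^'n"
  assumes g: "g \<in> limiting_subdiff p xb"
    and V: "range ((*v) V) = V_space p xb g"
    and U: "orthonormal_basis_matrix U ((V_space p xb g)\<^sup>\<bottom>)"
    and v: "v 0 = 0"
    and \<pi>: "\<forall>\<^sub>F u in nhds 0. p (xb + U *v u + V *v v u) = ereal (\<pi> u)"
    and min: "\<forall>\<^sub>F \<epsilon> in at_right 0. \<forall>\<^sub>F u in nhds 0. v u \<in> U_minimizers \<epsilon> p xb U V g u"
    and D: "GDERIV (\<lambda>u. \<pi> u - g \<bullet> (V *v v u)) 0 :> D"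
  shows "U *v D = U *v (transpose U *v g)"
proof -
  let ?W = "V_space p xb g" and ?l = "\<lambda>u. \<pi> u - g \<bullet> (V *v v u)"
  have W: "subspace ?W" by (simp add: V_space_def)
  define g' where "g' = U *v D + g - U *v (transpose U *v g)"
  have pxb: "p xb = ereal (\<pi> 0)"
    using eventually_nhds_x_imp_x[OF \<pi>] v by simp
  \<comment> \<open>The residual of the projection to the U-space lies in the V-space, its own
    double orthogonal complement. Hence it factors through \<open>V\<close>, and \<open>B\<close>
    computes V-coordinates.\<close>
  have "range ((*v) (mat 1 - U ** transpose U)) \<subseteq> range ((*v) V)"
  proof safe
    fix h
    have "h - U *v (transpose U *v h) \<in> ?W\<^sup>\<bottom>\<^sup>\<bottom>"
      by (rule orthonormal_basis_matrix_residual[OF U])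
    then show "(mat 1 - U ** transpose U) *v h \<in> range ((*v) V)"
      by (simp add: V orthogonal_comp_self[OF W] matrix_vector_mult_diff_rdistrib
          matrix_vector_mul_assoc del: transpose_matrix_vector)
  qed
  then obtain B where B: "mat 1 - U ** transpose U = V ** B"
    using matrix_factor_through_range by blast
  have VB: "V *v (B *v h) = h - U *v (transpose U *v h)" for h
    using arg_cong[OF B, of "\<lambda>M. M *v h"]
    by (simp add: matrix_vector_mult_diff_rdistrib matrix_vector_mul_assoc
        del: transpose_matrix_vector)
  obtain \<epsilon> where "\<epsilon> > 0" and min\<epsilon>: "\<forall>\<^sub>F u in nhds 0. v u \<in> U_minimizers \<epsilon> p xb U V g u"
    using eventually_happens'[OF trivial_limit_at_right_real
        eventually_conj[OF eventually_at_right_less min]] by blast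
  have lim: "((\<lambda>y. M *v (y - xb)) \<longlongrightarrow> 0) (at xb)" for M :: "real^'n^'k"
  proof -
    have "isCont (\<lambda>y. M *v (y - xb)) xb"
      by (rule isCont_o2[where f = "\<lambda>y. y - xb"]) (intro continuous_intros, intro linear_continuous_at, simp)
    then show ?thesis by (simp add: isCont_def)
  qed
  \<comment> \<open>The bound \<open>K\<close> converts the tolerance \<open>e / K\<close> in the
    U-coordinates into the tolerance \<open>e\<close> in \<open>y - xb\<close>.\<close>
  obtain K where "K > 0" and K: "\<And>h. norm (transpose U *v h) \<le> K * norm h"
    using linear_bounded_pos[of "(*v) (transpose U)"] by auto
  have "g' \<in> regular_subdiff p xb"
    unfolding regular_subdiff_def mem_Collect_eq
  proof (intro conjI allI impI)
    show "\<bar>p xb\<bar> \<noteq> \<infinity>" by (simp add: pxb)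
    fix e :: real assume "e > 0"
    then have "e / K > 0" using \<open>K > 0\<close> by simp
    then obtain d where "d > 0"
      and d: "\<And>u. norm (u - 0) < d \<Longrightarrow> norm (?l u - ?l 0 - (u - 0) \<bullet> D) \<le> e / K * norm (u - 0)"
      using D unfolding gderiv_def has_derivative_at_alt by blast
    have "\<forall>\<^sub>F y in at xb. v (transpose U *v (y - xb)) \<in> U_minimizers \<epsilon> p xb U V g (transpose U *v (y - xb))"
      "\<forall>\<^sub>F y in at xb. p (xb + U *v (transpose U *v (y - xb)) + V *v v (transpose U *v (y - xb)))
          = ereal (\<pi> (transpose U *v (y - xb)))"
      using eventually_compose_filterlim[OF min\<epsilon> lim] eventually_compose_filterlim[OF \<pi> lim] by blast+
    moreover have "\<forall>\<^sub>F y in at xb. norm (B *v (y - xb)) < \<epsilon>" "\<forall>\<^sub>F y in at xb. norm (transpose U *v (y - xb)) < d"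
      using tendstoD[OF lim \<open>\<epsilon> > 0\<close>] tendstoD[OF lim \<open>d > 0\<close>]
      by (simp_all add: dist_norm del: transpose_matrix_vector)
    ultimately show "\<forall>\<^sub>F y in at xb. p xb + ereal (g' \<bullet> (y - xb) - e * norm (y - xb)) \<le> p y"
    proof eventually_elim
      case (elim y)
      let ?h = "y - xb"
      let ?u = "transpose U *v ?h"
      \<comment> \<open>Splitting \<open>y - xb\<close> into its U-part and V-part makes
        \<open>B *v ?h\<close> a competitor of the track at the same \<open>?u\<close>.\<close>
      have y: "xb + U *v ?u + V *v (B *v ?h) = y" by (simp add: VB)
      have "U_objective p xb U V g ?u (v ?u) \<le> U_objective p xb U V g ?u (B *v ?h)"
        using elim(1,3) by (simp add: U_minimizers_def)
      then have "ereal (?l ?u) \<le> p y - ereal (g \<bullet> (?h - U *v ?u))"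
        by (simp only: U_objective_def y elim(2) ereal_minus(1)) (simp only: VB)
      moreover have "\<pi> 0 + ?u \<bullet> D - e * norm ?h \<le> ?l ?u"
      proof -
        have "\<bar>?l ?u - \<pi> 0 - ?u \<bullet> D\<bar> \<le> e / K * norm ?u"
          using d[of ?u] elim(4) v by simp
        also have "\<dots> \<le> e / K * (K * norm ?h)"
          using \<open>e / K > 0\<close> by (intro mult_left_mono K) simp
        finally show ?thesis using \<open>K > 0\<close> by simp
      qed
      moreover have "g' \<bullet> ?h = ?u \<bullet> D + g \<bullet> (?h - U *v ?u)"
      proof -
        have "(U *v a) \<bullet> ?h = ?u \<bullet> a" for a
          by (simp only: inner_matrix_vector_mult_transpose inner_commute)
        moreover have "g \<bullet> (U *v ?u) = ?u \<bullet> (transpose U *v g)"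
          by (metis inner_matrix_vector_mult_transpose inner_commute)
        ultimately show ?thesis
          by (simp only: g'_def inner_add_left inner_diff_left inner_diff_right[of g ?h])
      qed
      ultimately show ?case
        unfolding pxb by (cases "p y") auto
    qed
  qed
  then have "g' \<in> limiting_subdiff p xb"
    unfolding limiting_subdiff_def mem_Collect_eq
    by (intro conjI exI[of _ "\<lambda>_. xb"] exI[of _ "\<lambda>_. g'"] allI tendsto_const) (simp_all add: pxb)
  then have "g' - g \<in> ?W"
    unfolding V_space_def by (auto intro: span_base)
  moreover have "g' - g = U *v (D - transpose U *v g)"
    by (simp add: g'_def matrix_vector_mult_diff_distrib)
  then have "g' - g \<in> ?W\<^sup>\<bottom>"
    using orthonormal_basis_matrix_range[OF U] by auto
  ultimately have "g' - g = 0"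
    by (auto simp: orthogonal_comp_def orthogonal_def)
  then show ?thesis by (simp add: g'_def)
qed

section \<open>The U-gradient of the sum\<close>

lemma U_gradient_eqI:
  assumes "\<And>D. Lagrangian_gradient f xb U V g D \<longleftrightarrow> GDERIV l 0 :> D"
    and "GDERIV l 0 :> E"
  shows "U_differentiable f xb U V g" "U_gradient f xb U V g = U *v E"
proof -
  show "U_differentiable f xb U V g"
    using assms by (auto simp: U_differentiable_def)
  have "(THE D. Lagrangian_gradient f xb U V g D) = E"
    using assms GDERIV_unique by (intro the_equality) auto
  then show "U_gradient f xb U V g = U *v E"
    by (simp add: U_gradient_def)
qed


theorem theorem5p1:
  fixes p f :: "real^'n \<Rightarrow> ereal" and q :: "real^'n \<Rightarrow> real" and xb gp :: "real^'n"
    and M :: "(real^'n) set" and d :: nat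
    and U :: "real^'u^'n" and V :: "real^'v^'n" and track :: "real^'u \<Rightarrow> real^'n"
  assumes f: "\<And>x. f x = p x + ereal (q x)"
    and xb: "f xb < \<infinity>"
    and q: "C2_on UNIV q"
    and p: "PDG_structure p xb M"
    and gp: "gp \<in> rel_interior (limiting_subdiff p xb)"
    and U: "orthonormal_basis_matrix U (U_space p xb gp)"
    and V: "basis_matrix V (V_space p xb gp)"
    and track: "fast_track p xb M d U V track"
  shows "rel_interior (limiting_subdiff f xb) \<noteq> {} \<and>
    U_differentiable p xb U V gp \<and>
    (\<forall>gf \<in> rel_interior (limiting_subdiff f xb).
       U_space f xb gf = U_space p xb gp \<and>
       V_space f xb gf = V_space p xb gp \<and>
       (\<forall>Vf :: real^'v^'n. basis_matrix Vf (V_space f xb gf) \<longrightarrow>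
          U_differentiable f xb U Vf gf \<and>
          U_gradient f xb U Vf gf
            = U_gradient p xb U V gp + (U ** transpose U) *v grad q xb \<and>
          U_gradient p xb U V gp + (U ** transpose U) *v grad q xb
            = U_gradient p xb U V gp + U *v restrict_U U (grad q xb)))"
proof -
  let ?S = "limiting_subdiff p xb" and ?a = "grad q xb" and ?W = "V_space p xb gp"
  \<comment> \<open>The subdifferential is translated by \<open>?a\<close>, so the dual parameters
    of \<open>f\<close> are those of \<open>p\<close> shifted by \<open>?a\<close>.\<close>
  have ri: "rel_interior (limiting_subdiff f xb) = (\<lambda>g. ?a + g) ` rel_interior ?S"
    by (simp add: limiting_subdiff_add_smooth[OF f q] rel_interior_translation)
  have riS: "g \<in> ?S" if "g \<in> rel_interior ?S" for g
    using that rel_interior_subset by blast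
  have Vp: "V_space p xb g = ?W" if "g \<in> rel_interior ?S" for g
    unfolding V_space_def by (rule span_diff_base_eq) (use that gp riS in auto)
  have Vf: "V_space f xb (?a + g) = ?W" if "g \<in> rel_interior ?S" for g
    using Vp[OF that] by (simp add: V_space_def limiting_subdiff_add_smooth[OF f q] image_image)
  have U': "orthonormal_basis_matrix U (?W\<^sup>\<bottom>)"
    using U U_space_eq_orthogonal_comp[OF gp] by simp
  have rV: "range ((*v) V) = ?W" by (rule basis_matrix_range[OF V])
  obtain v \<pi> where v: "v 0 = 0" "v differentiable (at 0)" and d\<pi>: "\<pi> differentiable (at (0::real^'u))"
    and \<pi>: "\<forall>\<^sub>F u in nhds 0. p (xb + U *v u + V *v v u) = ereal (\<pi> u)"
    and min: "\<And>g. g \<in> rel_interior (limiting_subdiff p xb) \<Longrightarrow>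
       \<forall>\<^sub>F \<epsilon> in at_right 0. \<forall>\<^sub>F u in nhds 0. v u \<in> U_minimizers \<epsilon> p xb U V g u"
    using fast_track_local_minimizers[OF track] gp by blast
  obtain v' where v': "(v has_derivative v') (at 0)" using v(2) by (auto simp: differentiable_def)
  have Vv': "((\<lambda>u. V *v v u) has_derivative (\<lambda>h. V *v v' h)) (at 0)"
    by (rule bounded_linear.has_derivative[OF _ v']) simp
  \<comment> \<open>Subgradients of \<open>p\<close> differ by elements of the V-space, which
    \<open>transpose U\<close> annihilates.\<close>
  have UU: "U *v (transpose U *v g) = U *v (transpose U *v gp)" if g: "g \<in> rel_interior ?S" for g
  proof -
    have "g - gp \<in> ?W" using riS[OF g] unfolding V_space_def by (auto intro: span_base)
    moreover have "U *v h \<in> ?W\<^sup>\<bottom>" for h using orthonormal_basis_matrix_range[OF U'] by auto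
    ultimately have "(U *v h) \<bullet> (g - gp) = 0" for h
      by (simp add: orthogonal_comp_def orthogonal_def inner_commute[of "U *v h"])
    then have "h \<bullet> (transpose U *v (g - gp)) = 0" for h
      by (simp only: inner_matrix_vector_mult_transpose)
    then have "transpose U *v (g - gp) = 0" by (metis inner_eq_zero_iff)
    then show ?thesis by (simp add: matrix_vector_mult_diff_distrib del: transpose_matrix_vector)
  qed
  have grad: "\<exists>D. GDERIV (\<lambda>u. \<pi> u - g \<bullet> (V *v v u)) 0 :> D \<and> U *v D = U *v (transpose U *v gp)"
    if g: "g \<in> rel_interior ?S" for g
  proof -
    have "(\<lambda>u. g \<bullet> (V *v v u)) differentiable (at 0)"
      using has_derivative_inner_right[OF Vv'] by (auto simp: differentiable_def)
    then obtain D where D: "GDERIV (\<lambda>u. \<pi> u - g \<bullet> (V *v v u)) 0 :> D"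
      using differentiable_imp_GDERIV[OF differentiable_diff[OF d\<pi>]] by blast
    with U_gradient_fast_track[OF riS[OF g] _ _ v(1) \<pi> min[OF g]] show ?thesis
      using UU[OF g] Vp[OF g] rV U' by auto
  qed
  obtain Dp where Dp: "GDERIV (\<lambda>u. \<pi> u - gp \<bullet> (V *v v u)) 0 :> Dp"
      "U *v Dp = U *v (transpose U *v gp)"
    using grad[OF gp] by blast
  note grad_p = U_gradient_eqI[OF Lagrangian_gradient_iff[OF min[OF gp] \<pi>] Dp(1)]
  have main: "U_differentiable f xb U Vf (?a + g) \<and>
      U_gradient f xb U Vf (?a + g) = U_gradient p xb U V gp + (U ** transpose U) *v ?a"
    if g: "g \<in> rel_interior ?S" and Vf: "basis_matrix Vf ?W" for g and Vf :: "real^'v^'n"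
  proof -
    \<comment> \<open>In the coordinates of \<open>Vf\<close> the V-part of the track of
      \<open>p\<close> becomes \<open>B *v v u\<close>.\<close>
    obtain A B where A: "Vf = V ** A" and B: "V = Vf ** B"
      using range_eq_imp_matrix_factors[of V Vf] rV basis_matrix_range[OF Vf] by metis
    let ?\<chi> = "\<lambda>u. xb + U *v u + V *v v u"
    have VB: "Vf *v (B *v u) = V *v u" for u
      by (simp add: matrix_vector_mul_assoc flip: B)
    have min_f: "\<forall>\<^sub>F \<epsilon> in at_right 0. \<forall>\<^sub>F u in nhds 0. B *v v u \<in> U_minimizers \<epsilon> f xb U Vf (?a + g) u"
      using U_minimizers_add_smooth[OF f q g _ v(1) _ \<pi> min A B] rV Vp[OF g] v(2)
        differentiable_imp_continuous_within by blast
    have \<pi>_f: "\<forall>\<^sub>F u in nhds 0. f (xb + U *v u + Vf *v (B *v v u)) = ereal (\<pi> u + q (?\<chi> u))"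
      using \<pi> by eventually_elim (simp add: f VB)
    obtain D where D: "GDERIV (\<lambda>u. \<pi> u - g \<bullet> (V *v v u)) 0 :> D"
        "U *v D = U *v (transpose U *v gp)"
      using grad[OF g] by blast
    have "((*v) U has_derivative (*v) U) (at 0)"
      by (rule bounded_linear_imp_has_derivative) simp
    then have "(?\<chi> has_derivative (\<lambda>h. U *v h + V *v v' h)) (at 0)"
      using Vv' by (auto intro!: derivative_eq_intros)
    moreover have "(q has_derivative (\<lambda>h. h \<bullet> ?a)) (at (?\<chi> 0))"
      using C2_on_GDERIV[OF q, of xb] v(1) by (simp add: gderiv_def)
    ultimately have "((\<lambda>u. q (?\<chi> u)) has_derivative (\<lambda>h. (U *v h + V *v v' h) \<bullet> ?a)) (at 0)"
      by (rule has_derivative_compose)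
    \<comment> \<open>Tilting by \<open>?a\<close> cancels the V-component of the velocity of the
      track, so only the U-coordinates of \<open>?a\<close> remain.\<close>
    from has_derivative_diff[OF this has_derivative_inner_right[OF Vv', of ?a]]
    have "GDERIV (\<lambda>u. q (?\<chi> u) - ?a \<bullet> (V *v v u)) 0 :> transpose U *v ?a"
      by (simp add: gderiv_def inner_add_left inner_commute[of ?a]
          inner_matrix_vector_mult_transpose[of U] del: transpose_matrix_vector)
    from GDERIV_add[OF D(1) this]
    have "GDERIV (\<lambda>u. \<pi> u + q (?\<chi> u) - (?a + g) \<bullet> (Vf *v (B *v v u))) 0 :> D + transpose U *v ?a"
      by (simp add: VB inner_add_left algebra_simps del: transpose_matrix_vector)
    note U_gradient_eqI[OF Lagrangian_gradient_iff[OF min_f \<pi>_f] this]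
    then show ?thesis
      using grad_p(2) D(2) Dp(2)
      by (simp add: matrix_vector_right_distrib matrix_vector_mul_assoc del: transpose_matrix_vector)
  qed
  show ?thesis
  proof (intro conjI ballI allI impI)
    show "rel_interior (limiting_subdiff f xb) \<noteq> {}" using gp ri by blast
    show "U_differentiable p xb U V gp" by (rule grad_p(1))
    fix gf assume gf: "gf \<in> rel_interior (limiting_subdiff f xb)"
    then obtain g where g: "gf = ?a + g" "g \<in> rel_interior ?S" using ri by auto
    show VfW: "V_space f xb gf = ?W" using Vf g by simp
    \<comment> \<open>Both U-spaces are orthogonal complements of the common V-space.\<close>
    then show "U_space f xb gf = U_space p xb gp"
      using U_space_eq_orthogonal_comp[OF gf] U_space_eq_orthogonal_comp[OF gp] by simp
    fix Vf :: "real^'v^'n" assume "basis_matrix Vf (V_space f xb gf)"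
    then have "basis_matrix Vf ?W" using VfW by simp
    from main[OF g(2) this] show "U_differentiable f xb U Vf gf"
      "U_gradient f xb U Vf gf = U_gradient p xb U V gp + (U ** transpose U) *v ?a"
      by (simp_all add: g(1))
    show "U_gradient p xb U V gp + (U ** transpose U) *v ?a
        = U_gradient p xb U V gp + U *v restrict_U U ?a"
      by (simp add: restrict_U_def matrix_vector_mul_assoc del: transpose_matrix_vector)
  qed
qed

end
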